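(* Let $v,d\ge1$ be integers and let $\xi$ be an $E$-optimal approximate block design for comparisons of the test treatments $1,\dots,v$ with the control $0$ in $d$ blocks. Then: (i) $\xi$ is optimal for $\tilde c^T\tau$, where $\tilde c^T=(-1,1_v^T/v)$, i.e. $\xi$ is $\tilde c$-optimal; (ii) $\xi$ minimizes the variance of the least squares estimator of $\left(\sum_{i=1}^v\tau_i\right)/v-\tau_0$; (iii) $\xi$ minimizes $$\sum_{i=1}^v\mathrm{Var}(\widehat{\tau_i-\tau_0})+\sum_{1\le i\ne j\le v}\left|\mathrm{Cov}(\widehat{\tau_i-\tau_0},\widehat{\tau_j-\tau_0})\right|.$$ Here minimization is over all feasible approximate block designs with the given $v$ and $d$.
   Context: Treatments are labelled $0,1,\dots,v$ ($0$ is the control, the others are test treatments); blocks are labelled $1,\dots,d$. The model is $Y_j=\mu+\tau_{i(j)}+\theta_{k(j)}+\varepsilon_j$, with treatment effects $\tau=(\tau_0,\dots,\tau_v)^T$, block effects $\theta_1,\dots,\theta_d$, and uncorrelated zero-mean errors of common variance $\sigma^2<\infty$. An approximate (block) design is a function $\xi:\{0,\dots,v\}\times\{1,\dots,d\}\to[0,1]$ with $\sum_{i,k}\xi(i,k)=1$ such that $s_k(\xi):=\sum_{i=0}^v\xi(i,k)>0$ for all $k$ (the block sizes are otherwise not fixed). Put $s^{-1}=(s_1^{-1},\dots,s_d^{-1})$, $r_i=\sum_k\xi(i,k)$, $r=(r_0,\dots,r_v)^T$, $X(\xi)=(\xi(i,k))_{0\le i\le v,\,1\le k\le d}$, $Z(\xi)=(\xi(i,k))_{1\le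 i\le v,\,1\le k\le d}$. Let $M(\xi)=\mathrm{diag}(r)-X\,\mathrm{diag}(s^{-1})X^T$ and $Q=(-1_v,I_v)^T$, where $1_v$ is the all-ones vector, so $Q^T\tau=(\tau_1-\tau_0,\dots,\tau_v-\tau_0)^T$. The design $\xi$ is feasible if the column space of $Q$ is contained in the column space of $M(\xi)$. The information matrix for treatment-control comparisons is the $v\times v$ matrix $$N(\xi)=\mathrm{diag}(r_1,\dots,r_v)-Z\,\mathrm{diag}(s^{-1})Z^T=(Q^TM^-(\xi)Q)^{-1}$$ for feasible $\xi$, where $M^-$ denotes any generalized inverse. A feasible approximate design is $E$-optimal (for comparisons with a control) if it minimizes the largest eigenvalue of $N^{-1}(\xi)$ among all feasible approximate designs with the given $v$ and $d$. For $c\in\mathbb R^{v+1}$, a design is $c$-optimal (optimal for $c^T\tau$) if it minimizes the variance of the least squares estimator of $c^T\tau$, i.e. minimizes $c^TM^-(\xi)c$ among designs for which $c$ lies in the column space of $M(\xi)$. (For $c=\tilde c$ this condition is equivalent to feasibility.) For an approximate design, variances and covariances are those given, up to a common positive constant not depending on $\xi$, by these quantities: $\mathrm{Var}(\widehat{c^T\tau})$ is $c^TM^-(\xi)c$, and $\mathrm{Cov}(\widehat{\tau_i-\tau_0},\widehat{\tau_j-\tau_0})$ is the $(i,j)$ entry of $N^{-1}(\xi)$ (with $i=j$ giving the variance). *)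

theory Defs
  imports "HOL-Analysis.Analysis"
begin

text \<open>
  The test treatments are the elements of a finite type \<open>'v\<close> and the blocks those of a finite
  type \<open>'d\<close>, so \<open>v = CARD('v) \<ge> 1\<close> and \<open>d = CARD('d) \<ge> 1\<close> are arbitrary. The treatments are the
  elements of \<open>'v option\<close>: \<open>None\<close> is the control (treatment 0), \<open>Some i\<close> a test treatment.
\<close>

definition diag_mat :: "real ^ 'n \<Rightarrow> real ^ 'n ^ 'n" where
  "diag_mat x = (\<chi> i j. if i = j then x $ i else 0)"

definition col_space :: "real ^ 'n ^ 'm \<Rightarrow> (real ^ 'm) set" where
  "col_space A = span (columns A)"

definition is_eigenvalue :: "real ^ 'n ^ 'n \<Rightarrow> real \<Rightarrow> bool" where
  "is_eigenvalue A l \<longleftrightarrow> (\<exists>x. x \<noteq> 0 \<and> A *v x = l *\<^sub>R x)"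

text \<open>Only meaningful when the set of real eigenvalues is finite and nonempty, e.g. for symmetric
  matrices, the only ones it is applied to.\<close>

definition max_eigenvalue :: "real ^ 'n ^ 'n \<Rightarrow> real" where
  "max_eigenvalue A = Max {l. is_eigenvalue A l}"

definition is_ginv :: "real ^ 'm ^ 'n \<Rightarrow> real ^ 'n ^ 'm \<Rightarrow> bool" where
  "is_ginv G A \<longleftrightarrow> A ** G ** A = A"

definition ginv :: "real ^ 'n ^ 'm \<Rightarrow> real ^ 'm ^ 'n" where
  "ginv A = (SOME G. is_ginv G A)"


definition block_size :: "('v::finite option \<Rightarrow> 'd::finite \<Rightarrow> real) \<Rightarrow> 'd \<Rightarrow> real" where
  "block_size \<xi> k = (\<Sum>i\<in>UNIV. \<xi> i k)"

definition approx_design :: "('v::finite option \<Rightarrow> 'd::finite \<Rightarrow> real) \<Rightarrow> bool" where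
  "approx_design \<xi> \<longleftrightarrow>
     (\<forall>i k. 0 \<le> \<xi> i k \<and> \<xi> i k \<le> 1) \<and>
     (\<Sum>i\<in>UNIV. \<Sum>k\<in>UNIV. \<xi> i k) = 1 \<and>
     (\<forall>k. block_size \<xi> k > 0)"

definition inv_sizes :: "('v::finite option \<Rightarrow> 'd::finite \<Rightarrow> real) \<Rightarrow> real ^ 'd" where
  "inv_sizes \<xi> = (\<chi> k. inverse (block_size \<xi> k))"

definition replication :: "('v::finite option \<Rightarrow> 'd::finite \<Rightarrow> real) \<Rightarrow> 'v option \<Rightarrow> real" where
  "replication \<xi> i = (\<Sum>k\<in>UNIV. \<xi> i k)"

definition X_mat :: "('v::finite option \<Rightarrow> 'd::finite \<Rightarrow> real) \<Rightarrow> real ^ 'd ^ 'v option" where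
  "X_mat \<xi> = (\<chi> i k. \<xi> i k)"

definition Z_mat :: "('v::finite option \<Rightarrow> 'd::finite \<Rightarrow> real) \<Rightarrow> real ^ 'd ^ 'v" where
  "Z_mat \<xi> = (\<chi> i k. \<xi> (Some i) k)"

definition M_mat ::
    "('v::finite option \<Rightarrow> 'd::finite \<Rightarrow> real) \<Rightarrow> real ^ 'v option ^ 'v option" where
  "M_mat \<xi> = diag_mat (\<chi> i. replication \<xi> i)
     - X_mat \<xi> ** diag_mat (inv_sizes \<xi>) ** transpose (X_mat \<xi>)"

definition Q_mat :: "real ^ 'v ^ 'v::finite option" where
  "Q_mat = (\<chi> i j. case i of None \<Rightarrow> -1 | Some i' \<Rightarrow> if i' = j then 1 else 0)"

definition feasible :: "('v::finite option \<Rightarrow> 'd::finite \<Rightarrow> real) \<Rightarrow> bool" where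
  "feasible \<xi> \<longleftrightarrow>
     approx_design \<xi> \<and> col_space (Q_mat :: real ^ 'v ^ 'v option) \<subseteq> col_space (M_mat \<xi>)"

definition N_mat :: "('v::finite option \<Rightarrow> 'd::finite \<Rightarrow> real) \<Rightarrow> real ^ 'v ^ 'v" where
  "N_mat \<xi> = diag_mat (\<chi> i. replication \<xi> (Some i))
     - Z_mat \<xi> ** diag_mat (inv_sizes \<xi>) ** transpose (Z_mat \<xi>)"

definition E_optimal :: "('v::finite option \<Rightarrow> 'd::finite \<Rightarrow> real) \<Rightarrow> bool" where
  "E_optimal \<xi> \<longleftrightarrow> is_arg_min (\<lambda>\<eta>. max_eigenvalue (matrix_inv (N_mat \<eta>))) feasible \<xi>"


text \<open>Variances and covariances are taken up to the common factor \<open>\<sigma>\<^sup>2\<close> (and number of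
  observations), which does not depend on the design.\<close>

definition ls_var :: "('v::finite option \<Rightarrow> 'd::finite \<Rightarrow> real) \<Rightarrow> real ^ 'v option \<Rightarrow> real" where
  "ls_var \<xi> c = c \<bullet> (ginv (M_mat \<xi>) *v c)"

definition estimable :: "('v::finite option \<Rightarrow> 'd::finite \<Rightarrow> real) \<Rightarrow> real ^ 'v option \<Rightarrow> bool" where
  "estimable \<xi> c \<longleftrightarrow> c \<in> col_space (M_mat \<xi>)"

definition c_optimal :: "real ^ 'v option \<Rightarrow> ('v::finite option \<Rightarrow> 'd::finite \<Rightarrow> real) \<Rightarrow> bool" where
  "c_optimal c \<xi> \<longleftrightarrow>
     is_arg_min (\<lambda>\<eta>. ls_var \<eta> c) (\<lambda>\<eta>. approx_design \<eta> \<and> estimable \<eta> c) \<xi>"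

definition c_tilde :: "real ^ 'v::finite option" where
  "c_tilde = (\<chi> i. case i of None \<Rightarrow> -1 | Some _ \<Rightarrow> 1 / real CARD('v))"

text \<open>The vector \<open>c\<close> with \<open>L \<tau> = c\<^sup>T \<tau>\<close>, for a linear functional \<open>L\<close> of the treatment effects.\<close>

definition coeff_vec :: "(real ^ 'n \<Rightarrow> real) \<Rightarrow> real ^ 'n" where
  "coeff_vec L = (\<chi> i. L (axis i 1))"

definition ls_var_of ::
    "('v::finite option \<Rightarrow> 'd::finite \<Rightarrow> real) \<Rightarrow> (real ^ 'v option \<Rightarrow> real) \<Rightarrow> real" where
  "ls_var_of \<xi> L = ls_var \<xi> (coeff_vec L)"

text \<open>The covariance of the least squares estimators of \<open>\<tau>\<^sub>i - \<tau>\<^sub>0\<close> and \<open>\<tau>\<^sub>j - \<tau>\<^sub>0\<close>, under a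
  feasible design.\<close>

definition tc_cov :: "('v::finite option \<Rightarrow> 'd::finite \<Rightarrow> real) \<Rightarrow> 'v \<Rightarrow> 'v \<Rightarrow> real" where
  "tc_cov \<xi> i j = matrix_inv (N_mat \<xi>) $ i $ j"

definition tc_var :: "('v::finite option \<Rightarrow> 'd::finite \<Rightarrow> real) \<Rightarrow> 'v \<Rightarrow> real" where
  "tc_var \<xi> i = tc_cov \<xi> i i"


text \<open>Well-definedness: \<open>max_eigenvalue\<close> is a maximum over a finite set for symmetric matrices,
  generalized inverses exist, and \<open>ls_var \<xi> c\<close> does not depend on the one chosen.\<close>

lemma finite_eigenvalues:
  fixes A :: "real ^ 'n ^ 'n"
  assumes sym: "transpose A = A"
  shows "finite {l. is_eigenvalue A l}"
proof -
  define e where "e l = (SOME x. x \<noteq> 0 \<and> A *v x = l *\<^sub>R x)" for l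
  have e: "e l \<noteq> 0" "A *v e l = l *\<^sub>R e l" if "is_eigenvalue A l" for l
    using that someI_ex[of "\<lambda>x. x \<noteq> 0 \<and> A *v x = l *\<^sub>R x"]
    unfolding is_eigenvalue_def e_def by blast+
  have orth: "e l \<bullet> e m = 0" if "is_eigenvalue A l" "is_eigenvalue A m" "l \<noteq> m" for l m
  proof -
    have "(A *v e l) \<bullet> e m = e l \<bullet> (A *v e m)"
      by (metis dot_lmul_matrix sym vector_transpose_matrix)
    then have "l * (e l \<bullet> e m) = m * (e l \<bullet> e m)"
      using that e by simp
    then show ?thesis using that by simp
  qed
  let ?E = "{l. is_eigenvalue A l}"
  have inj: "inj_on e ?E"
  proof (rule inj_onI)
    fix l m assume "l \<in> ?E" "m \<in> ?E" "e l = e m"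
    then show "l = m" using orth[of l m] e(1)[of l] by (cases "l = m") auto
  qed
  have "pairwise orthogonal (e ` ?E)"
    unfolding pairwise_def orthogonal_def using orth by fastforce
  then have "finite (e ` ?E)"
    by (rule pairwise_orthogonal_imp_finite)
  then show ?thesis using inj finite_imageD by blast
qed

lemma is_ginv_ginv: "is_ginv (ginv A) A"
proof -
  obtain g where "linear g" and g: "\<forall>y\<in>range ((*v) A). A *v g y = y"
    using linear_exists_right_inverse_on[of "(*v) A" UNIV] by auto
  then have "g = (*v) (matrix g)"
    by (simp add: fun_eq_iff)
  then have "A ** matrix g ** A = A"
    using g by (subst matrix_eq) (metis matrix_vector_mul_assoc rangeI)
  then have "\<exists>G. is_ginv G A" unfolding is_ginv_def by blast
  then show ?thesis unfolding ginv_def by (rule someI_ex)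
qed

lemma transpose_diag_mat: "transpose (diag_mat x) = diag_mat x"
  by (auto simp: transpose_def diag_mat_def vec_eq_iff)

lemma transpose_diff: "transpose (A - B) = transpose A - transpose (B :: real ^ 'n ^ 'm)"
  by (simp add: transpose_def vec_eq_iff)

lemma transpose_M_mat: "transpose (M_mat \<xi>) = M_mat \<xi>"
  by (simp add: M_mat_def transpose_diff transpose_diag_mat matrix_transpose_mul matrix_mul_assoc)

lemma ls_var_ginv:
  assumes "estimable \<xi> c" and G: "is_ginv G (M_mat \<xi>)"
  shows "ls_var \<xi> c = c \<bullet> (G *v c)"
proof -
  let ?M = "M_mat \<xi>"
  have "col_space ?M = range ((*v) ?M)"
  proof
    have "columns ?M \<subseteq> range ((*v) ?M)"
      using columns_image_basis[of ?M] by auto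
    then show "col_space ?M \<subseteq> range ((*v) ?M)"
      unfolding col_space_def
      by (intro span_minimal linear_subspace_image matrix_vector_mul_linear subspace_UNIV)
    show "range ((*v) ?M) \<subseteq> col_space ?M"
      unfolding col_space_def using matrix_vector_mult_in_columnspace by blast
  qed
  then obtain x where x: "c = ?M *v x"
    using assms unfolding estimable_def by auto
  have "c \<bullet> (H *v c) = x \<bullet> c" if "is_ginv H ?M" for H
    using that unfolding is_ginv_def x
    by (metis dot_lmul_matrix transpose_M_mat vector_transpose_matrix matrix_vector_mul_assoc)
  then show ?thesis using G is_ginv_ginv unfolding ls_var_def by metis
qed

end

theory Submission
  imports Defs
begin

text \<open>
  The three criteria are governed by a single number. Let \<open>1\<close> be the all-ones vector of
  length \<open>v\<close>. The average test treatment minus the control is estimated with variance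
  \<open>(1 \<bullet> N\<^sup>-\<^sup>1 1) / v\<^sup>2\<close>; this is the criterion of (i) and (ii). The criterion of (iii) is at least
  the sum of all entries of \<open>N\<^sup>-\<^sup>1\<close>, which is \<open>1 \<bullet> N\<^sup>-\<^sup>1 1\<close>, and equals it because \<open>N\<^sup>-\<^sup>1\<close> has
  nonnegative entries, as \<open>N\<close> is positive definite with nonpositive off-diagonal entries
  (\<open>inverse_N_mat_nonneg\<close>). So it is enough to show that an E-optimal design minimizes
  \<open>1 \<bullet> N\<^sup>-\<^sup>1 1\<close>.

  The value \<open>4 v\<^sup>2\<close> is a lower bound for every feasible design. If \<open>t\<close> is the weight that a block of size
  \<open>s\<close> gives to the test treatments, then \<open>1 \<bullet> N 1\<close> is the sum of \<open>t - t\<^sup>2 / s \<le> s / 4\<close> over the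
  blocks, hence at most \<open>1 / 4\<close> (\<open>N_mat_ones_le\<close>), and Cauchy--Schwarz gives
  \<open>v\<^sup>2 \<le> (1 \<bullet> N 1) (1 \<bullet> N\<^sup>-\<^sup>1 1)\<close> (\<open>ls_var_c_tilde_ge\<close>).

  An E-optimal design attains the bound. The design that gives half of every block to the control
  and splits the rest evenly has \<open>4 v\<close> as the largest eigenvalue of \<open>N\<^sup>-\<^sup>1\<close>, with eigenvector \<open>1\<close>.
  An E-optimal design does no worse, and \<open>1 \<bullet> N\<^sup>-\<^sup>1 1\<close> is at most the largest eigenvalue times
  \<open>1 \<bullet> 1 = v\<close>, so it is at most \<open>4 v\<^sup>2\<close> (\<open>E_optimal_ls_var_c_tilde_le\<close>).

  The variance and feasibility are defined through \<open>M\<close>; the factorization \<open>M = Q N Q\<^sup>T\<close>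
  (\<open>M_mat_vector\<close>) translates them into statements about \<open>N\<close>.
\<close>

section \<open>Symmetric and positive semidefinite matrices\<close>

lemma symmetric_matrix_dot:
  fixes A :: "real ^ 'n ^ 'n"
  assumes "transpose A = A"
  shows "x \<bullet> (A *v y) = (A *v x) \<bullet> y"
  by (metis assms dot_lmul_matrix vector_transpose_matrix)

lemma psd_Cauchy_Schwarz:
  fixes A :: "real ^ 'n ^ 'n"
  assumes sym: "transpose A = A" and psd: "\<And>x. 0 \<le> x \<bullet> (A *v x)"
  shows "(x \<bullet> (A *v y))\<^sup>2 \<le> (x \<bullet> (A *v x)) * (y \<bullet> (A *v y))"
proof -
  define a b c where "a = x \<bullet> (A *v x)" and "b = x \<bullet> (A *v y)" and "c = y \<bullet> (A *v y)"
  have swap: "y \<bullet> (A *v x) = b"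
    using symmetric_matrix_dot[OF sym, of y x] by (simp add: b_def inner_commute)
  have form: "0 \<le> s\<^sup>2 * a - 2 * s * t * b + t\<^sup>2 * c" for s t
  proof -
    have "(s *\<^sub>R x - t *\<^sub>R y) \<bullet> (A *v (s *\<^sub>R x - t *\<^sub>R y)) = s\<^sup>2 * a - 2 * s * t * b + t\<^sup>2 * c"
      by (simp add: matrix_vector_mult_diff_distrib matrix_vector_mult_scaleR inner_diff_left
          inner_diff_right swap a_def[symmetric] b_def[symmetric] c_def[symmetric]
          power2_eq_square algebra_simps)
    then show ?thesis using psd by metis
  qed
  have "0 \<le> c" unfolding c_def by (rule psd)
  then consider "c > 0" | "c = 0" by linarith
  then have "b\<^sup>2 \<le> a * c"
  proof cases
    case 1
    \<comment> \<open>the form at \<open>c x - b y\<close>, a multiple of the part of \<open>x\<close> orthogonal to \<open>y\<close> for the form\<close>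
    have "0 \<le> c * (a * c - b\<^sup>2)"
      using form[of c b] by (simp add: power2_eq_square algebra_simps)
    then show ?thesis using 1 by (simp add: zero_le_mult_iff)
  next
    case 2
    have "b = 0"
    proof (rule ccontr)
      assume "b \<noteq> 0"
      \<comment> \<open>for isotropic \<open>y\<close> the form at \<open>x - t y\<close> is \<open>a - 2 t b\<close>; this \<open>t\<close> makes it \<open>- 1\<close>\<close>
      then show False using form[of 1 "(a + 1) / (2 * b)"] 2 psd[of x] by (simp add: a_def)
    qed
    then show ?thesis using 2 by simp
  qed
  then show ?thesis unfolding a_def b_def c_def .
qed

lemma psd_isotropic_imp_kernel:
  fixes A :: "real ^ 'n ^ 'n"
  assumes "transpose A = A" and "\<And>x. 0 \<le> x \<bullet> (A *v x)" and "x \<bullet> (A *v x) = 0"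
  shows "A *v x = 0"
  using psd_Cauchy_Schwarz[OF assms(1,2), of "A *v x" x] assms(3) by simp

text \<open>The Rayleigh quotient attains its maximum \<open>m\<close> over the unit sphere by compactness. Then
  \<open>m I - A\<close> is positive semidefinite and vanishes at the maximiser as a quadratic form, so the
  maximiser lies in its kernel, that is, it is an eigenvector of \<open>A\<close> for \<open>m\<close>.\<close>

lemma symmetric_Rayleigh_eigenvalue:
  fixes A :: "real ^ 'n ^ 'n"
  assumes sym: "transpose A = A"
  obtains m where "is_eigenvalue A m" and "\<And>y. y \<bullet> (A *v y) \<le> m * (y \<bullet> y)"
proof -
  have "continuous_on (sphere 0 1) (\<lambda>x. x \<bullet> (A *v x))"
    by (intro continuous_intros linear_continuous_on_compose[OF continuous_on_id])
      (rule matrix_vector_mul_linear)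
  then have "\<exists>x\<in>sphere 0 1. \<forall>y\<in>sphere 0 1. y \<bullet> (A *v y) \<le> x \<bullet> (A *v x)"
    by (intro continuous_attains_sup) simp_all
  then obtain x where x: "norm x = 1"
    and max: "\<And>y. norm y = 1 \<Longrightarrow> y \<bullet> (A *v y) \<le> x \<bullet> (A *v x)"
    by auto
  define m where "m = x \<bullet> (A *v x)"
  have bound: "y \<bullet> (A *v y) \<le> m * (y \<bullet> y)" for y
  proof (cases "y = 0")
    case False
    have "(y /\<^sub>R norm y) \<bullet> (A *v (y /\<^sub>R norm y)) \<le> m"
      unfolding m_def using False by (intro max) simp
    then have "(y \<bullet> (A *v y)) / (norm y)\<^sup>2 \<le> m"
      by (simp add: matrix_vector_mult_scaleR power2_eq_square divide_inverse mult_ac)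
    then show ?thesis
      using False by (simp add: pos_divide_le_eq power2_norm_eq_inner)
  qed simp
  let ?B = "m *\<^sub>R mat 1 - A"
  have B: "?B *v y = m *\<^sub>R y - A *v y" for y
    by (simp add: matrix_vector_mult_diff_rdistrib scaleR_matrix_vector_assoc[symmetric])
  have "transpose ?B = ?B"
  proof -
    have "transpose (m *\<^sub>R mat 1 :: real ^ 'n ^ 'n) = m *\<^sub>R mat 1"
      by (simp add: transpose_def mat_def vec_eq_iff)
    then show ?thesis by (simp add: transpose_diff sym)
  qed
  moreover have "0 \<le> y \<bullet> (?B *v y)" for y
    using bound[of y] by (simp add: B inner_diff_right)
  moreover have "x \<bullet> (?B *v x) = 0"
    unfolding B using x
    by (simp add: inner_diff_right power2_norm_eq_inner[symmetric] m_def[symmetric])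
  ultimately have "A *v x = m *\<^sub>R x"
    using psd_isotropic_imp_kernel[of ?B x] by (simp add: B)
  moreover have "x \<noteq> 0" using x by auto
  ultimately have "is_eigenvalue A m"
    unfolding is_eigenvalue_def by blast
  then show thesis using bound that by blast
qed

lemma Rayleigh_le_max_eigenvalue:
  fixes A :: "real ^ 'n ^ 'n"
  assumes sym: "transpose A = A"
  shows "y \<bullet> (A *v y) \<le> max_eigenvalue A * (y \<bullet> y)"
proof -
  obtain m where m: "is_eigenvalue A m" and le: "y \<bullet> (A *v y) \<le> m * (y \<bullet> y)"
    using symmetric_Rayleigh_eigenvalue[OF sym] by metis
  have "m \<le> max_eigenvalue A"
    unfolding max_eigenvalue_def using m finite_eigenvalues[OF sym] by (intro Max_ge) auto
  then have "m * (y \<bullet> y) \<le> max_eigenvalue A * (y \<bullet> y)"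
    by (intro mult_right_mono) auto
  with le show ?thesis by linarith
qed

lemma max_eigenvalue_le:
  fixes A :: "real ^ 'n ^ 'n"
  assumes sym: "transpose A = A" and le: "\<And>l. is_eigenvalue A l \<Longrightarrow> l \<le> b"
  shows "max_eigenvalue A \<le> b"
proof -
  have "{l. is_eigenvalue A l} \<noteq> {}"
    using symmetric_Rayleigh_eigenvalue[OF sym] by blast
  then show ?thesis
    unfolding max_eigenvalue_def using finite_eigenvalues[OF sym] le by (subst Max_le_iff) auto
qed

lemma matrix_inv_works:
  fixes A :: "real ^ 'n ^ 'n"
  assumes "invertible A"
  shows "A ** matrix_inv A = mat 1" and "matrix_inv A ** A = mat 1"
proof -
  have "A ** matrix_inv A = mat 1 \<and> matrix_inv A ** A = mat 1"
    using assms unfolding matrix_inv_def invertible_def by (rule someI_ex)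
  then show "A ** matrix_inv A = mat 1" and "matrix_inv A ** A = mat 1" by auto
qed

lemma matrix_inv_vector:
  fixes A :: "real ^ 'n ^ 'n"
  assumes "invertible A"
  shows "A *v (matrix_inv A *v x) = x" and "matrix_inv A *v (A *v x) = x"
  by (simp_all add: matrix_vector_mul_assoc matrix_inv_works[OF assms])

lemma transpose_matrix_inv:
  fixes A :: "real ^ 'n ^ 'n"
  assumes "invertible A" and "transpose A = A"
  shows "transpose (matrix_inv A) = matrix_inv A"
proof -
  have "transpose (matrix_inv A) ** A = mat 1"
    using matrix_inv_works(1)[OF assms(1)] assms(2)
    by (metis matrix_transpose_mul transpose_mat)
  then have "transpose (matrix_inv A) ** A ** matrix_inv A = matrix_inv A"
    by simp
  then show ?thesis
    by (simp add: matrix_mul_assoc[symmetric] matrix_inv_works(1)[OF assms(1)])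
qed

text \<open>Split a solution of \<open>A x = b\<close> into its positive part \<open>p\<close> and its negative part \<open>q\<close>. Their
  supports are disjoint, so \<open>q \<bullet> A p \<le> 0\<close>, and \<open>0 \<le> q \<bullet> b = q \<bullet> A p - q \<bullet> A q\<close> forces \<open>q \<bullet> A q \<le> 0\<close>.
  Definiteness leaves only \<open>q = 0\<close>.\<close>

lemma psd_nonpos_offdiag_solution_nonneg:
  fixes A :: "real ^ 'n ^ 'n"
  assumes sym: "transpose A = A" and psd: "\<And>x. 0 \<le> x \<bullet> (A *v x)" and inv: "invertible A"
    and off: "\<And>i j. i \<noteq> j \<Longrightarrow> A $ i $ j \<le> 0"
    and b: "\<And>i. 0 \<le> (A *v x) $ i"
  shows "0 \<le> x $ i"
proof -
  define p q where "p = (\<chi> i. max (x $ i) 0)" and "q = (\<chi> i. max (- x $ i) 0)"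
  have x: "x = p - q"
    by (auto simp: p_def q_def vec_eq_iff)
  have "q \<bullet> (A *v p) = (\<Sum>i\<in>UNIV. \<Sum>j\<in>UNIV. q $ i * (A $ i $ j * p $ j))"
    by (simp add: inner_vec_def matrix_vector_mult_def sum_distrib_left)
  also have "\<dots> \<le> 0"
  proof (intro sum_nonpos)
    fix i j
    show "q $ i * (A $ i $ j * p $ j) \<le> 0"
    proof (cases "i = j")
      case True
      then show ?thesis by (auto simp: p_def q_def max_def)
    next
      case False
      then have "A $ i $ j * p $ j \<le> 0"
        using off by (intro mult_nonpos_nonneg) (auto simp: p_def)
      moreover have "0 \<le> q $ i" by (simp add: q_def)
      ultimately show ?thesis by (rule mult_nonneg_nonpos[rotated])
    qed
  qed
  finally have "q \<bullet> (A *v p) \<le> 0" .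
  moreover have "0 \<le> q \<bullet> (A *v x)"
    unfolding inner_vec_def using b by (intro sum_nonneg) (simp add: q_def)
  moreover have "q \<bullet> (A *v x) = q \<bullet> (A *v p) - q \<bullet> (A *v q)"
    by (simp add: x matrix_vector_mult_diff_distrib inner_diff_right)
  ultimately have "q \<bullet> (A *v q) = 0"
    using psd[of q] by linarith
  then have "A *v q = 0"
    by (rule psd_isotropic_imp_kernel[OF sym psd])
  then have "q = 0"
    using matrix_inv_vector(2)[OF inv, of q] by simp
  then have "max (- x $ i) 0 = 0"
    by (simp add: q_def vec_eq_iff)
  then show ?thesis by linarith
qed


section \<open>The two information matrices\<close>

lemma sum_UNIV_option:
  fixes f :: "'a::finite option \<Rightarrow> 'b::comm_monoid_add"
  shows "sum f UNIV = f None + (\<Sum>i\<in>UNIV. f (Some i))"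
  by (simp add: UNIV_option_conv sum.reindex)

lemma mult_diag_mat_transpose:
  "(X ** diag_mat w ** transpose X) $ i $ j = (\<Sum>k\<in>UNIV. X $ i $ k * w $ k * X $ j $ k)"
  by (simp add: matrix_matrix_mult_def diag_mat_def transpose_def if_distrib
      cong: if_cong)

lemma M_mat_entry:
  "M_mat \<xi> $ i $ j = (if i = j then replication \<xi> i else 0)
     - (\<Sum>k\<in>UNIV. \<xi> i k * \<xi> j k / block_size \<xi> k)"
  unfolding M_mat_def vector_minus_component mult_diag_mat_transpose
  by (simp add: diag_mat_def X_mat_def inv_sizes_def divide_inverse mult_ac)

lemma N_mat_entry: "N_mat \<xi> $ i $ j = M_mat \<xi> $ Some i $ Some j"
  unfolding M_mat_entry N_mat_def vector_minus_component mult_diag_mat_transpose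
  by (simp add: diag_mat_def Z_mat_def inv_sizes_def divide_inverse mult_ac)

lemma transpose_N_mat: "transpose (N_mat \<xi>) = N_mat \<xi>"
  using transpose_M_mat[of \<xi>] by (simp add: vec_eq_iff transpose_def N_mat_entry)

lemma block_size_pos: "approx_design \<xi> \<Longrightarrow> 0 < block_size \<xi> k"
  by (simp add: approx_design_def)

lemma M_mat_row_sum:
  assumes "approx_design \<xi>"
  shows "(\<Sum>j\<in>UNIV. M_mat \<xi> $ i $ j) = 0"
proof -
  have "(\<Sum>j\<in>UNIV. \<Sum>k\<in>UNIV. \<xi> i k * \<xi> j k / block_size \<xi> k)
      = (\<Sum>k\<in>UNIV. \<xi> i k / block_size \<xi> k * block_size \<xi> k)"
    by (subst sum.swap) (simp add: block_size_def sum_distrib_left)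
  also have "\<dots> = replication \<xi> i"
    unfolding replication_def
    by (intro sum.cong) (use block_size_pos[OF assms] in \<open>auto simp: less_imp_neq[THEN not_sym]\<close>)
  finally show ?thesis
    by (simp add: M_mat_entry sum_subtractf)
qed

lemma Q_mat_vector: "Q_mat *v z = (\<chi> i. case i of None \<Rightarrow> - (\<Sum>j\<in>UNIV. z $ j) | Some j \<Rightarrow> z $ j)"
  by (auto simp: vec_eq_iff matrix_vector_mult_def Q_mat_def if_distrib[of "\<lambda>x. x * _"] sum_negf
      split: option.split cong: if_cong)

lemma transpose_Q_mat_vector: "transpose Q_mat *v x = (\<chi> j. x $ Some j - x $ None)"
  by (simp add: vec_eq_iff matrix_vector_mult_def transpose_def Q_mat_def sum_UNIV_option
      if_distrib[of "\<lambda>x. x * _"] cong: if_cong)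

lemma Q_mat_inject: "Q_mat *v y = Q_mat *v z \<longleftrightarrow> y = z"
  by (auto simp: Q_mat_vector vec_eq_iff split: option.splits)

lemma surj_transpose_Q_mat: "surj ((*v) (transpose Q_mat :: real ^ 'v::finite option ^ 'v))"
proof (rule surjI)
  fix z :: "real ^ 'v"
  show "transpose Q_mat *v (\<chi> i. case i of None \<Rightarrow> 0 | Some j \<Rightarrow> z $ j) = z"
    unfolding transpose_Q_mat_vector by (simp add: vec_eq_iff)
qed

text \<open>\<open>M = Q N Q\<^sup>T\<close>: the rows and columns of \<open>M\<close> sum to zero, so \<open>M\<close> is determined by its block
  \<open>N\<close> and sees only the differences with the control. This reduces questions about \<open>M\<close>, its
  column space and its generalized inverses to \<open>N\<close>, which is nonsingular for feasible designs.\<close>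

lemma M_mat_vector:
  assumes "approx_design \<xi>"
  shows "M_mat \<xi> *v x = Q_mat *v (N_mat \<xi> *v (transpose Q_mat *v x))"
proof -
  have col: "(\<Sum>i\<in>UNIV. M_mat \<xi> $ i $ j) = 0" for j
  proof -
    have "M_mat \<xi> $ i $ j = M_mat \<xi> $ j $ i" for i
      by (subst transpose_M_mat[symmetric]) (simp add: transpose_def)
    then show ?thesis using M_mat_row_sum[OF assms, of j] by simp
  qed
  have Some: "(M_mat \<xi> *v x) $ Some i = (N_mat \<xi> *v (transpose Q_mat *v x)) $ i" for i
  proof -
    have "M_mat \<xi> $ Some i $ None = - (\<Sum>j\<in>UNIV. N_mat \<xi> $ i $ j)"
      using M_mat_row_sum[OF assms, of "Some i"] by (simp add: sum_UNIV_option N_mat_entry)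
    then show ?thesis
      by (simp add: matrix_vector_mult_def[of "M_mat \<xi>"] matrix_vector_mult_def[of "N_mat \<xi>"]
          sum_UNIV_option transpose_Q_mat_vector N_mat_entry right_diff_distrib sum_subtractf
          sum_distrib_right del: transpose_matrix_vector)
  qed
  have "(\<Sum>i\<in>UNIV. (M_mat \<xi> *v x) $ i) = 0"
  proof -
    have "(\<Sum>i\<in>UNIV. (M_mat \<xi> *v x) $ i) = (\<Sum>j\<in>UNIV. (\<Sum>i\<in>UNIV. M_mat \<xi> $ i $ j) * x $ j)"
      by (simp add: matrix_vector_mult_def sum_distrib_right) (rule sum.swap)
    then show ?thesis by (simp add: col)
  qed
  then have None: "(M_mat \<xi> *v x) $ None = - (\<Sum>i\<in>UNIV. (M_mat \<xi> *v x) $ Some i)"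
    by (simp add: sum_UNIV_option)
  show ?thesis
    by (simp add: vec_eq_iff Q_mat_vector None Some split: option.split)
qed

lemma col_space_eq_range: "col_space (A :: real ^ 'n ^ 'm) = range ((*v) A)"
proof
  have "columns A \<subseteq> range ((*v) A)"
    using columns_image_basis[of A] by auto
  then show "col_space A \<subseteq> range ((*v) A)"
    unfolding col_space_def
    by (intro span_minimal linear_subspace_image matrix_vector_mul_linear subspace_UNIV)
  show "range ((*v) A) \<subseteq> col_space A"
    unfolding col_space_def using matrix_vector_mult_in_columnspace by blast
qed

lemma Q_mat_in_col_space_M_mat_iff:
  assumes "approx_design \<xi>"
  shows "Q_mat *v z \<in> col_space (M_mat \<xi>) \<longleftrightarrow> z \<in> range ((*v) (N_mat \<xi>))"
proof -
  have "Q_mat *v z \<in> col_space (M_mat \<xi>)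
      \<longleftrightarrow> z \<in> (*v) (N_mat \<xi>) ` range ((*v) (transpose Q_mat))"
    unfolding col_space_eq_range image_iff M_mat_vector[OF assms] Q_mat_inject
    by (simp only: bex_simps)
  then show ?thesis by (simp only: surj_transpose_Q_mat)
qed

text \<open>\<open>Q\<close> is injective and \<open>Q\<^sup>T\<close> is onto, so the column space of \<open>Q N Q\<^sup>T\<close> contains that of \<open>Q\<close>
  exactly when \<open>N\<close> is onto.\<close>

lemma feasible_iff_invertible:
  "feasible \<xi> \<longleftrightarrow> approx_design \<xi> \<and> invertible (N_mat \<xi>)"
proof (cases "approx_design \<xi>")
  case True
  have "feasible \<xi> \<longleftrightarrow> (\<forall>z. Q_mat *v z \<in> col_space (M_mat \<xi>))"
    using True unfolding feasible_def col_space_eq_range[of Q_mat] by auto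
  also have "\<dots> \<longleftrightarrow> surj ((*v) (N_mat \<xi>))"
    unfolding Q_mat_in_col_space_M_mat_iff[OF True] by auto
  also have "\<dots> \<longleftrightarrow> invertible (N_mat \<xi>)"
    using matrix_right_invertible_surjective[of "N_mat \<xi>"] invertible_right_inverse by blast
  finally show ?thesis using True by simp
qed (simp add: feasible_def)

text \<open>The quadratic form of a generalized inverse at \<open>M x\<close> is \<open>x \<bullet> M x\<close>. With \<open>M = Q N Q\<^sup>T\<close> and
  \<open>z = Q\<^sup>T x\<close>, the coefficient vector is \<open>Q (N z)\<close> and the variance is \<open>z \<bullet> N z\<close>.\<close>

lemma ls_var_Q_mat:
  assumes "approx_design \<xi>"
  shows "ls_var \<xi> (Q_mat *v (N_mat \<xi> *v z)) = z \<bullet> (N_mat \<xi> *v z)"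
proof -
  let ?M = "M_mat \<xi>"
  obtain x where z: "z = transpose Q_mat *v x"
    using surj_transpose_Q_mat by (rule surjE)
  then have Mx: "Q_mat *v (N_mat \<xi> *v z) = ?M *v x"
    by (simp add: M_mat_vector[OF assms])
  have "?M *v (ginv ?M *v (?M *v x)) = ?M *v x"
    using is_ginv_ginv[of ?M] by (simp add: is_ginv_def matrix_vector_mul_assoc matrix_mul_assoc)
  then have "ls_var \<xi> (?M *v x) = x \<bullet> (?M *v x)"
    unfolding ls_var_def by (metis symmetric_matrix_dot[OF transpose_M_mat])
  also have "\<dots> = z \<bullet> (N_mat \<xi> *v z)"
    unfolding Mx[symmetric] z by (simp add: dot_lmul_matrix)
  finally show ?thesis by (simp add: Mx)
qed


section \<open>The quadratic form of N\<close>

lemma N_mat_quadratic_form: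
  "z \<bullet> (N_mat \<xi> *v z) = (\<Sum>k\<in>UNIV. (\<Sum>i\<in>UNIV. \<xi> (Some i) k * (z $ i)\<^sup>2)
      - (\<Sum>i\<in>UNIV. \<xi> (Some i) k * z $ i)\<^sup>2 / block_size \<xi> k)"
proof -
  let ?s = "block_size \<xi>"
  have "z \<bullet> (N_mat \<xi> *v z) = (\<Sum>i\<in>UNIV. \<Sum>j\<in>UNIV. z $ i * (N_mat \<xi> $ i $ j * z $ j))"
    by (simp add: inner_vec_def matrix_vector_mult_def sum_distrib_left)
  also have "\<dots> = (\<Sum>i\<in>UNIV. \<Sum>j\<in>UNIV. if i = j then replication \<xi> (Some i) * (z $ i)\<^sup>2 else 0)
      - (\<Sum>i\<in>UNIV. \<Sum>j\<in>UNIV. \<Sum>k\<in>UNIV.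
          (\<xi> (Some i) k * z $ i) * (\<xi> (Some j) k * z $ j) / ?s k)"
    unfolding sum_subtractf[symmetric]
    by (intro sum.cong refl)
      (auto simp: N_mat_entry M_mat_entry left_diff_distrib right_diff_distrib sum_distrib_left
        sum_distrib_right power2_eq_square mult_ac)
  also have "(\<Sum>i\<in>UNIV. \<Sum>j\<in>UNIV. if i = j then replication \<xi> (Some i) * (z $ i)\<^sup>2 else 0)
      = (\<Sum>k\<in>UNIV. \<Sum>i\<in>UNIV. \<xi> (Some i) k * (z $ i)\<^sup>2)"
    by (subst sum.swap) (simp add: replication_def sum_distrib_right, rule sum.swap)
  also have "(\<Sum>i\<in>UNIV. \<Sum>j\<in>UNIV. \<Sum>k\<in>UNIV.
        (\<xi> (Some i) k * z $ i) * (\<xi> (Some j) k * z $ j) / ?s k)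
      = (\<Sum>i\<in>UNIV. \<Sum>k\<in>UNIV. \<Sum>j\<in>UNIV.
        (\<xi> (Some i) k * z $ i) * (\<xi> (Some j) k * z $ j) / ?s k)"
    by (intro sum.cong refl sum.swap)
  also have "\<dots> = (\<Sum>k\<in>UNIV. \<Sum>i\<in>UNIV. \<Sum>j\<in>UNIV.
        (\<xi> (Some i) k * z $ i) * (\<xi> (Some j) k * z $ j) / ?s k)"
    by (rule sum.swap)
  also have "\<dots> = (\<Sum>k\<in>UNIV. (\<Sum>i\<in>UNIV. \<xi> (Some i) k * z $ i)\<^sup>2 / ?s k)"
    by (simp add: power2_eq_square sum_product sum_divide_distrib)
  finally show ?thesis by (simp add: sum_subtractf)
qed

text \<open>Every block contributes a nonnegative amount, by Cauchy--Schwarz with weights \<open>\<xi> (Some i) k\<close>,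
  because these weights add up to at most the block size.\<close>

lemma N_mat_psd:
  assumes \<xi>: "approx_design \<xi>"
  shows "0 \<le> z \<bullet> (N_mat \<xi> *v z)"
  unfolding N_mat_quadratic_form
proof (rule sum_nonneg)
  fix k
  let ?w = "\<lambda>i. \<xi> (Some i) k"
  let ?S = "\<Sum>i\<in>UNIV. ?w i * (z $ i)\<^sup>2"
  have nonneg: "0 \<le> \<xi> i k" for i
    using \<xi> by (simp add: approx_design_def)
  have "(\<Sum>i\<in>UNIV. ?w i * z $ i)\<^sup>2 = (\<Sum>i\<in>UNIV. sqrt (?w i) * (sqrt (?w i) * z $ i))\<^sup>2"
    by (simp add: mult.assoc[symmetric] nonneg)
  also have "\<dots> \<le> (\<Sum>i\<in>UNIV. ?w i) * ?S"
    using Cauchy_Schwarz_ineq_sum[of "\<lambda>i. sqrt (?w i)" "\<lambda>i. sqrt (?w i) * z $ i" UNIV]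
    by (simp add: power_mult_distrib nonneg)
  also have "\<dots> \<le> block_size \<xi> k * ?S"
    by (intro mult_right_mono sum_nonneg) (auto simp: block_size_def sum_UNIV_option nonneg)
  finally have "(\<Sum>i\<in>UNIV. ?w i * z $ i)\<^sup>2 / block_size \<xi> k \<le> ?S"
    using block_size_pos[OF \<xi>] by (simp add: pos_divide_le_eq mult.commute)
  then show "0 \<le> ?S - (\<Sum>i\<in>UNIV. ?w i * z $ i)\<^sup>2 / block_size \<xi> k" by simp
qed

text \<open>A block of size \<open>s\<close> with weight \<open>t\<close> on the test treatments contributes \<open>t - t\<^sup>2 / s\<close>, which is
  largest, namely \<open>s / 4\<close>, when the control receives exactly half of the block. The block sizes
  add up to 1.\<close>

lemma N_mat_ones_le:
  assumes \<xi>: "approx_design \<xi>"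
  shows "1 \<bullet> (N_mat \<xi> *v 1) \<le> 1 / 4"
proof -
  have "1 \<bullet> (N_mat \<xi> *v 1) \<le> (\<Sum>k\<in>UNIV. block_size \<xi> k / 4)"
    unfolding N_mat_quadratic_form
  proof (rule sum_mono)
    fix k
    define s t where "s = block_size \<xi> k" and "t = (\<Sum>i\<in>UNIV. \<xi> (Some i) k)"
    have "0 < s" using block_size_pos[OF \<xi>] by (simp add: s_def)
    have "0 \<le> (s / 2 - t)\<^sup>2 / s" using \<open>0 < s\<close> by simp
    also have "\<dots> = s / 4 - (t - t\<^sup>2 / s)"
      using \<open>0 < s\<close> by (simp add: power2_eq_square field_simps)
    finally show "(\<Sum>i\<in>UNIV. \<xi> (Some i) k * (1 $ i)\<^sup>2)
        - (\<Sum>i\<in>UNIV. \<xi> (Some i) k * 1 $ i)\<^sup>2 / block_size \<xi> k \<le> block_size \<xi> k / 4"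
      by (simp add: s_def t_def)
  qed
  also have "\<dots> = (\<Sum>i\<in>UNIV. \<Sum>k\<in>UNIV. \<xi> i k) / 4"
    unfolding block_size_def sum_divide_distrib[symmetric] by (subst sum.swap) simp
  also have "\<dots> = 1 / 4" using \<xi> by (simp add: approx_design_def)
  finally show ?thesis .
qed

text \<open>The off-diagonal entries of \<open>N\<close> are \<open>- (\<Sum>k. \<xi> i k * \<xi> j k / s k) \<le> 0\<close>, and column \<open>j\<close> of the
  inverse solves \<open>N x = e\<close> for a unit vector \<open>e\<close>.\<close>

lemma inverse_N_mat_nonneg:
  assumes "feasible \<xi>"
  shows "0 \<le> matrix_inv (N_mat \<xi>) $ i $ j"
proof -
  have \<xi>: "approx_design \<xi>" and inv: "invertible (N_mat \<xi>)"
    using assms by (auto simp: feasible_iff_invertible)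
  have off: "N_mat \<xi> $ a $ b \<le> 0" if "a \<noteq> b" for a b
    using that \<xi> block_size_pos[OF \<xi>]
    by (auto simp: N_mat_entry M_mat_entry approx_design_def intro!: sum_nonneg divide_nonneg_pos)
  have "0 \<le> (matrix_inv (N_mat \<xi>) *v axis j 1) $ i"
    by (rule psd_nonpos_offdiag_solution_nonneg[OF transpose_N_mat N_mat_psd[OF \<xi>] inv off])
      (auto simp: matrix_inv_vector[OF inv] axis_def)
  then show ?thesis by (simp add: matrix_vector_mul_component inner_axis)
qed


section \<open>The variance of the comparison of the average test treatment with the control\<close>

lemma c_tilde_eq: "c_tilde = Q_mat *v (1 /\<^sub>R real CARD('v) :: real ^ 'v::finite)"
  by (auto simp: c_tilde_def Q_mat_vector vec_eq_iff divide_inverse split: option.split)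

lemma ls_var_c_tilde:
  fixes \<xi> :: "'v::finite option \<Rightarrow> 'd::finite \<Rightarrow> real"
  assumes "feasible \<xi>"
  shows "ls_var \<xi> c_tilde = 1 \<bullet> (matrix_inv (N_mat \<xi>) *v 1) / (real CARD('v))\<^sup>2"
proof -
  have \<xi>: "approx_design \<xi>" and inv: "invertible (N_mat \<xi>)"
    using assms by (auto simp: feasible_iff_invertible)
  define z where "z = matrix_inv (N_mat \<xi>) *v (1 /\<^sub>R real CARD('v))"
  have Nz: "N_mat \<xi> *v z = 1 /\<^sub>R real CARD('v)"
    by (simp add: z_def matrix_inv_vector[OF inv])
  then have "ls_var \<xi> c_tilde = z \<bullet> (1 /\<^sub>R real CARD('v))"
    using ls_var_Q_mat[OF \<xi>, of z] by (simp add: c_tilde_eq)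
  then show ?thesis
    by (simp add: z_def matrix_vector_mult_scaleR inner_commute power2_eq_square divide_inverse)
qed

text \<open>If \<open>N z\<close> is the constant vector \<open>1 / v\<close>, then the variance is \<open>z \<bullet> N z\<close> and \<open>1 \<bullet> N z = 1\<close>, so
  Cauchy--Schwarz for the form of \<open>N\<close> bounds the variance below by \<open>1 / (1 \<bullet> N 1)\<close>.\<close>

lemma ls_var_c_tilde_ge:
  fixes \<xi> :: "'v::finite option \<Rightarrow> 'd::finite \<Rightarrow> real"
  assumes \<xi>: "approx_design \<xi>" and est: "estimable \<xi> c_tilde"
  shows "4 \<le> ls_var \<xi> c_tilde"
proof -
  obtain z where z: "N_mat \<xi> *v z = 1 /\<^sub>R real CARD('v)"
    using est unfolding estimable_def c_tilde_eq Q_mat_in_col_space_M_mat_iff[OF \<xi>]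
    by (metis rangeE)
  have var: "ls_var \<xi> c_tilde = z \<bullet> (N_mat \<xi> *v z)"
    using ls_var_Q_mat[OF \<xi>, of z] by (simp add: c_tilde_eq z)
  have "1 \<bullet> (N_mat \<xi> *v z) = 1"
    by (simp add: z inner_vec_def)
  then have "1 \<le> (1 \<bullet> (N_mat \<xi> *v 1)) * ls_var \<xi> c_tilde"
    using psd_Cauchy_Schwarz[OF transpose_N_mat N_mat_psd[OF \<xi>], of 1 z] var by simp
  also have "\<dots> \<le> 1 / 4 * ls_var \<xi> c_tilde"
    using N_mat_ones_le[OF \<xi>] N_mat_psd[OF \<xi>, of z] var by (intro mult_right_mono) auto
  finally show ?thesis by simp
qed

lemma feasible_imp_estimable_c_tilde:
  assumes "feasible \<xi>"
  shows "estimable \<xi> c_tilde"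
  using assms unfolding feasible_def estimable_def c_tilde_eq col_space_eq_range by blast


section \<open>A design attaining the bound\<close>

text \<open>Half of every block is the extremal split for the control, and equal weights make \<open>1\<close> an
  eigenvector of \<open>N\<close>; these are the equality cases of the two inequalities behind the bound.\<close>

definition balanced_design :: "'v::finite option \<Rightarrow> 'd::finite \<Rightarrow> real" where
  "balanced_design i k = (case i of
     None \<Rightarrow> 1 / (2 * real CARD('d))
   | Some _ \<Rightarrow> 1 / (2 * real CARD('v) * real CARD('d)))"

lemma block_size_balanced_design:
  "block_size (balanced_design :: 'v::finite option \<Rightarrow> 'd::finite \<Rightarrow> real) k = 1 / real CARD('d)"
  by (simp add: block_size_def balanced_design_def sum_UNIV_option field_simps)

lemma approx_design_balanced_design:
  "approx_design (balanced_design :: 'v::finite option \<Rightarrow> 'd::finite \<Rightarrow> real)"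
proof -
  have v: "1 \<le> real CARD('v)" and d: "1 \<le> real CARD('d)"
    by (simp_all add: Suc_le_eq)
  have vd: "1 \<le> real CARD('v) * real CARD('d)"
    using mult_mono[OF v d] by simp
  have "1 / (2 * x) \<le> 1" if "1 \<le> x" for x :: real
    using that by (simp add: divide_le_eq)
  from this[OF d] this[OF vd] have "balanced_design i k \<le> 1" for i :: "'v option" and k :: 'd
    by (cases i) (simp_all add: balanced_design_def mult.assoc)
  moreover have "(\<Sum>i\<in>UNIV. \<Sum>k\<in>UNIV. balanced_design (i :: 'v option) (k :: 'd)) = 1"
    by (simp add: sum_UNIV_option balanced_design_def field_simps)
  ultimately show ?thesis
    by (auto simp: approx_design_def block_size_balanced_design)
      (simp add: balanced_design_def split: option.split)
qed

text \<open>Here \<open>N = I / (2 v) - J / (4 v\<^sup>2)\<close> with the all-ones matrix \<open>J\<close>, whose form is at most \<open>v\<close>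
  times the identity.\<close>

lemma N_mat_balanced_design_ge:
  fixes z :: "real ^ 'v::finite"
  shows "z \<bullet> z / (4 * real CARD('v))
    \<le> z \<bullet> (N_mat (balanced_design :: 'v option \<Rightarrow> 'd::finite \<Rightarrow> real) *v z)"
proof -
  define v where "v = real CARD('v)"
  define d where "d = real CARD('d)"
  have pos: "0 < v" "0 < d" by (simp_all add: v_def d_def)
  define S where "S = (\<Sum>i\<in>UNIV. z $ i)"
  have zz: "z \<bullet> z = (\<Sum>i\<in>UNIV. (z $ i)\<^sup>2)"
    by (simp add: inner_vec_def power2_eq_square)
  have S: "S\<^sup>2 \<le> v * (z \<bullet> z)"
    using Cauchy_Schwarz_ineq_sum[of "\<lambda>_. 1" "\<lambda>i. z $ i" UNIV]
    by (simp add: S_def v_def zz)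
  have "z \<bullet> (N_mat (balanced_design :: 'v option \<Rightarrow> 'd \<Rightarrow> real) *v z)
      = d * (1 / (2 * v * d) * (z \<bullet> z) - (1 / (2 * v * d) * S)\<^sup>2 * d)"
    by (simp add: N_mat_quadratic_form block_size_balanced_design)
      (simp add: balanced_design_def sum_divide_distrib[symmetric] zz S_def v_def d_def)
  also have "\<dots> = (2 * (z \<bullet> z) - S\<^sup>2 / v) / (4 * v)"
    using pos by (simp add: power2_eq_square field_simps)
  also have "\<dots> \<ge> z \<bullet> z / (4 * v)"
  proof -
    have "S\<^sup>2 / v \<le> z \<bullet> z"
      using S pos by (simp add: pos_divide_le_eq mult.commute)
    then show ?thesis using pos by (intro divide_right_mono) auto
  qed
  finally show ?thesis by (simp add: v_def)
qed

lemma feasible_balanced_design: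
  "feasible (balanced_design :: 'v::finite option \<Rightarrow> 'd::finite \<Rightarrow> real)"
proof -
  let ?N = "N_mat (balanced_design :: 'v option \<Rightarrow> 'd \<Rightarrow> real)"
  have "z = 0" if "?N *v z = 0" for z
    using N_mat_balanced_design_ge[of z, where 'd = 'd] that
    by (simp add: divide_le_0_iff power2_norm_eq_inner[symmetric])
  then have "invertible ?N"
    unfolding invertible_left_inverse matrix_left_invertible_ker by blast
  then show ?thesis
    by (simp add: feasible_iff_invertible approx_design_balanced_design)
qed

lemma max_eigenvalue_balanced_design_le:
  "max_eigenvalue (matrix_inv (N_mat (balanced_design :: 'v::finite option \<Rightarrow> 'd::finite \<Rightarrow> real)))
    \<le> 4 * real CARD('v)"
proof -
  let ?N = "N_mat (balanced_design :: 'v option \<Rightarrow> 'd \<Rightarrow> real)"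
  have inv: "invertible ?N"
    using feasible_balanced_design feasible_iff_invertible by blast
  show ?thesis
  proof (rule max_eigenvalue_le[OF transpose_matrix_inv[OF inv transpose_N_mat]])
    fix l
    assume "is_eigenvalue (matrix_inv ?N) l"
    then obtain x where x: "x \<noteq> 0" "matrix_inv ?N *v x = l *\<^sub>R x"
      unfolding is_eigenvalue_def by blast
    then have "x = l *\<^sub>R (?N *v x)"
      by (metis matrix_inv_vector(1)[OF inv] matrix_vector_mult_scaleR)
    then have xx: "x \<bullet> x = l * (x \<bullet> (?N *v x))"
      by (metis inner_scaleR_right)
    show "l \<le> 4 * real CARD('v)"
    proof (cases "l \<le> 0")
      case True
      have "0 \<le> 4 * real CARD('v)" by simp
      with True show ?thesis by linarith
    next
      case False
      then have "l * (x \<bullet> x / (4 * real CARD('v))) \<le> l * (x \<bullet> (?N *v x))"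
        by (intro mult_left_mono N_mat_balanced_design_ge) simp
      also have "\<dots> = x \<bullet> x" using xx by simp
      finally have "l * (x \<bullet> x) \<le> (4 * real CARD('v)) * (x \<bullet> x)"
        by (simp add: pos_divide_le_eq mult.commute)
      then show ?thesis using x(1) by simp
    qed
  qed
qed


section \<open>E-optimal designs\<close>

text \<open>Comparing with the balanced design gives \<open>\<lambda>\<^sub>m\<^sub>a\<^sub>x(N\<^sup>-\<^sup>1) \<le> 4 v\<close>; the Rayleigh quotient at \<open>1\<close>
  transfers this to \<open>1 \<bullet> N\<^sup>-\<^sup>1 1 \<le> 4 v\<^sup>2\<close>.\<close>

lemma E_optimal_ls_var_c_tilde_le:
  fixes \<xi> :: "'v::finite option \<Rightarrow> 'd::finite \<Rightarrow> real"
  assumes "E_optimal \<xi>"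
  shows "ls_var \<xi> c_tilde \<le> 4"
proof -
  let ?v = "real CARD('v)" and ?A = "matrix_inv (N_mat \<xi>)"
  have feas: "feasible \<xi>"
    using assms by (simp add: E_optimal_def is_arg_min_def)
  then have sym: "transpose ?A = ?A"
    by (simp add: feasible_iff_invertible transpose_matrix_inv transpose_N_mat)
  have "max_eigenvalue ?A
      \<le> max_eigenvalue (matrix_inv (N_mat (balanced_design :: 'v option \<Rightarrow> 'd \<Rightarrow> real)))"
    using assms feasible_balanced_design unfolding E_optimal_def is_arg_min_linorder by blast
  then have "max_eigenvalue ?A \<le> 4 * ?v"
    using max_eigenvalue_balanced_design_le[where 'v = 'v and 'd = 'd] by linarith
  moreover have "1 \<bullet> (?A *v 1) \<le> max_eigenvalue ?A * ?v"
    using Rayleigh_le_max_eigenvalue[OF sym, of 1] by (simp add: inner_vec_def)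
  ultimately have "1 \<bullet> (?A *v 1) \<le> 4 * ?v * ?v"
    by (meson mult_right_mono of_nat_0_le_iff order_trans)
  then show ?thesis
    by (simp add: ls_var_c_tilde[OF feas] pos_divide_le_eq power2_eq_square)
qed

lemma sum_cov:
  fixes \<eta> :: "'v::finite option \<Rightarrow> 'd::finite \<Rightarrow> real"
  shows "(\<Sum>i\<in>UNIV. tc_var \<eta> i) + (\<Sum>(i, j)\<in>{(i, j). i \<noteq> j}. tc_cov \<eta> i j)
    = 1 \<bullet> (matrix_inv (N_mat \<eta>) *v 1)"
proof -
  have "1 \<bullet> (matrix_inv (N_mat \<eta>) *v 1) = (\<Sum>(i, j)\<in>UNIV. tc_cov \<eta> i j)"
    by (simp add: inner_vec_def matrix_vector_mult_def tc_cov_def sum.cartesian_product)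
  also have "\<dots> = (\<Sum>(i, j)\<in>range (\<lambda>i. (i, i)). tc_cov \<eta> i j)
      + (\<Sum>(i, j)\<in>{(i, j). i \<noteq> j}. tc_cov \<eta> i j)"
    by (subst sum.union_disjoint[symmetric]) (auto intro!: sum.cong)
  also have "(\<Sum>(i, j)\<in>range (\<lambda>i. (i, i)). tc_cov \<eta> i j) = (\<Sum>i\<in>UNIV. tc_var \<eta> i)"
    by (subst sum.reindex) (auto simp: inj_on_def tc_var_def)
  finally show ?thesis by simp
qed

lemma coeff_vec_average_minus_control:
  "coeff_vec (\<lambda>\<tau>. (\<Sum>i\<in>UNIV. \<tau> $ Some i) / real CARD('v) - \<tau> $ None)
    = (c_tilde :: real ^ 'v::finite option)"
  by (auto simp: coeff_vec_def c_tilde_def vec_eq_iff axis_def split: option.split)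

theorem theorem2:
  fixes \<xi> :: "'v::finite option \<Rightarrow> 'd::finite \<Rightarrow> real"
  assumes "E_optimal \<xi>"
  shows "c_optimal c_tilde \<xi> \<and>
    is_arg_min (\<lambda>\<eta>. ls_var_of \<eta> (\<lambda>\<tau>. (\<Sum>i\<in>UNIV. \<tau> $ Some i) / real CARD('v) - \<tau> $ None))
      feasible \<xi> \<and>
    is_arg_min (\<lambda>\<eta>. (\<Sum>i\<in>UNIV. tc_var \<eta> i) +
                     (\<Sum>(i, j)\<in>{(i, j). i \<noteq> j}. \<bar>tc_cov \<eta> i j\<bar>))
      feasible \<xi>"
proof (intro conjI)
  have feas: "feasible \<xi>"
    using assms by (simp add: E_optimal_def is_arg_min_def)
  have approx: "approx_design \<eta>" if "feasible \<eta>" for \<eta> :: "'v option \<Rightarrow> 'd \<Rightarrow> real"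
    using that by (simp add: feasible_def)
  have min: "ls_var \<xi> c_tilde \<le> ls_var \<eta> c_tilde"
    if "approx_design \<eta>" "estimable \<eta> c_tilde" for \<eta> :: "'v option \<Rightarrow> 'd \<Rightarrow> real"
    using E_optimal_ls_var_c_tilde_le[OF assms] ls_var_c_tilde_ge[OF that] by linarith
  show "c_optimal c_tilde \<xi>"
    using min feas approx feasible_imp_estimable_c_tilde
    unfolding c_optimal_def is_arg_min_linorder by blast
  have min_feas: "ls_var \<xi> c_tilde \<le> ls_var \<eta> c_tilde" if "feasible \<eta>"
    for \<eta> :: "'v option \<Rightarrow> 'd \<Rightarrow> real"
    using min that approx feasible_imp_estimable_c_tilde by blast
  then show "is_arg_min
      (\<lambda>\<eta>. ls_var_of \<eta> (\<lambda>\<tau>. (\<Sum>i\<in>UNIV. \<tau> $ Some i) / real CARD('v) - \<tau> $ None)) feasible \<xi>"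
    using feas unfolding is_arg_min_linorder ls_var_of_def coeff_vec_average_minus_control by blast
  let ?f = "\<lambda>\<eta> :: 'v option \<Rightarrow> 'd \<Rightarrow> real. (\<Sum>i\<in>UNIV. tc_var \<eta> i) +
    (\<Sum>(i, j)\<in>{(i, j). i \<noteq> j}. \<bar>tc_cov \<eta> i j\<bar>)"
  have "?f \<xi> \<le> ?f \<eta>" if "feasible \<eta>" for \<eta>
  proof -
    \<comment> \<open>the absolute values can be dropped for \<open>\<xi>\<close>, and dropping them can only decrease the sum for \<open>\<eta>\<close>\<close>
    have "?f \<xi> = 1 \<bullet> (matrix_inv (N_mat \<xi>) *v 1)"
      unfolding sum_cov[symmetric] tc_cov_def using inverse_N_mat_nonneg[OF feas] by simp
    also have "\<dots> \<le> 1 \<bullet> (matrix_inv (N_mat \<eta>) *v 1)"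
      using min_feas[OF that]
      by (simp add: ls_var_c_tilde[OF feas] ls_var_c_tilde[OF that] divide_le_cancel)
    also have "\<dots> \<le> ?f \<eta>"
      unfolding sum_cov[symmetric] by (intro add_left_mono sum_mono) auto
    finally show ?thesis .
  qed
  then show "is_arg_min ?f feasible \<xi>"
    using feas unfolding is_arg_min_linorder by blast
qed

end
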